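(* If a kernel $g$ on the finite alphabet $S$ is regular and exhibits equilibrium phase transition, then it exhibits dynamic phase transition.
   Context: $S$ is a finite set, $\mathcal X=S^{\mathbb Z}$, $\mathcal X^-=S^{\{-1,-2,\dots\}}$. Sequences are written with the past to the right: $x_j^i=(x_i,\dots,x_j)$ for $j\le i$, $x_{-\infty}^i=(x_i,x_{i-1},\dots)$, $\underline x=x_{-\infty}^{-1}$; concatenations are read in the same order, sequences indexed by a left half-line of $\mathbb Z$ being identified by shifting indices. For $I\subset\mathbb R$, $\mathcal F_I$ is the $\sigma$-algebra on $\mathcal X$ generated by the coordinates with index in $I\cap\mathbb Z$; $\mathcal F=\mathcal F_{\mathbb R}$ and $\mathcal T^+=\bigcap_{n\ge1}\mathcal F_{[n,\infty)}$. A (probability) kernel $g$ on $S$ is a measurable function assigning to each $a\in S$, $\underline x\in\mathcal X^-$ a number $g(a\underline x)\in[0,1]$ with $\sum_{a\in S}g(a\underline x)=1$ for all $\underline x$. It is strongly non-null if $\inf_{a,\underline x}g(a\underline x)>0$. It is continuous if $\mathrm{var}_k(g)=\sup_{a\in S}\sup_{\omega_{-k}^{-1}\in S^k}\sup_{\underline x,\underline y\in\mathcal X^-}|g(a\omega_{-k}^{-1}\underline x)-g(a\omega_{-k}^{-1}\underline y)|\to0$ as $k\to\infty$. It is regular if it is strongly non-null and continuous. A $g$-measure is a stationary probability measure $P$ on $(\mathcal X,\mathcal F)$, with canonical process $(X_j)_{j\in\mathbb Z}$, such that $P[X_0=a\mid X_{-\infty}^{-1}=\underline x]=g(a\underline x)$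 for every $a\in S$ and $P$-a.e. $x$. $g$ exhibits equilibrium phase transition if there is more than one $g$-measure. For $\underline x\in\mathcal X^-$, $P^{\underline x}$ is the probability measure on $(\mathcal X,\mathcal F)$ under which $X_{-\infty}^{-1}=\underline x$ almost surely and, for $j\ge0$, $P^{\underline x}[X_j=a\mid X_{-\infty}^{j-1}=y_{-\infty}^{j-1}]=g(ay_{-\infty}^{j-1})$. $g$ exhibits dynamic uniqueness if $P^{\underline x}[A]=P^{\underline y}[A]$ for all $A\in\mathcal T^+$ and all $\underline x,\underline y\in\mathcal X^-$; otherwise it exhibits dynamic phase transition. *)

theory Defs
  imports "HOL-Probability.Probability" "HOL-Library.Omega_Words_Fun"
begin

text \<open>
  The alphabet is the finite type \<open>'a\<close>, configurations are functions \<open>int \<Rightarrow> 'a\<close>. A past is a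
  function \<open>u :: nat \<Rightarrow> 'a\<close> listing the symbols from the most recent one backwards, i.e.
  \<open>u n\<close> is the symbol at time \<open>- 1 - n\<close>. With this encoding the concatenation of a finite word
  with a past is the library operation \<open>w \<frown> u\<close> on lists and \<open>\<omega>\<close>-words, and \<open>g(a u)\<close>
  is written \<open>g a u\<close>.
\<close>

definition past :: "int \<Rightarrow> (int \<Rightarrow> 'a) \<Rightarrow> nat \<Rightarrow> 'a" where
  "past j x = (\<lambda>n. x (j - 1 - int n))"

definition coord_algebra :: "int set \<Rightarrow> (int \<Rightarrow> 'a) measure" where
  "coord_algebra I = sigma UNIV {{x. x i = a} |i a. i \<in> I}"

definition tail_events :: "(int \<Rightarrow> 'a) set set" where
  "tail_events = (\<Inter>n\<in>{1..}. sets (coord_algebra {n..}))"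

definition prob_kernel :: "('a::finite \<Rightarrow> (nat \<Rightarrow> 'a) \<Rightarrow> real) \<Rightarrow> bool" where
  "prob_kernel g \<longleftrightarrow>
     (\<forall>a. g a \<in> borel_measurable (Pi\<^sub>M UNIV (\<lambda>_. count_space UNIV))) \<and>
     (\<forall>a u. g a u \<in> {0..1}) \<and>
     (\<forall>u. (\<Sum>a\<in>UNIV. g a u) = 1)"

definition strongly_non_null :: "('a::finite \<Rightarrow> (nat \<Rightarrow> 'a) \<Rightarrow> real) \<Rightarrow> bool" where
  "strongly_non_null g \<longleftrightarrow> (INF (a, u). g a u) > 0"

definition variation :: "nat \<Rightarrow> ('a::finite \<Rightarrow> (nat \<Rightarrow> 'a) \<Rightarrow> real) \<Rightarrow> real" where
  "variation k g =
     (SUP (a, w, u, v) \<in> UNIV \<times> {w. length w = k} \<times> UNIV \<times> UNIV. \<bar>g a (w \<frown> u) - g a (w \<frown> v)\<bar>)"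

definition continuous_kernel :: "('a::finite \<Rightarrow> (nat \<Rightarrow> 'a) \<Rightarrow> real) \<Rightarrow> bool" where
  "continuous_kernel g \<longleftrightarrow> (\<lambda>k. variation k g) \<longlonglongrightarrow> 0"

definition regular_kernel :: "('a::finite \<Rightarrow> (nat \<Rightarrow> 'a) \<Rightarrow> real) \<Rightarrow> bool" where
  "regular_kernel g \<longleftrightarrow> strongly_non_null g \<and> continuous_kernel g"

definition stationary :: "(int \<Rightarrow> 'a) measure \<Rightarrow> bool" where
  "stationary P \<longleftrightarrow> distr P P (\<lambda>x i. x (i + 1)) = P"

text \<open>Under \<open>P\<close>, the conditional law of the coordinate \<open>X\<^sub>j\<close> given all earlier ones is \<open>g\<close>.\<close>

definition follows_kernel_at ::
  "('a::finite \<Rightarrow> (nat \<Rightarrow> 'a) \<Rightarrow> real) \<Rightarrow> (int \<Rightarrow> 'a) measure \<Rightarrow> int \<Rightarrow> bool" where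
  "follows_kernel_at g P j \<longleftrightarrow>
     (\<forall>a. AE x in P. real_cond_exp P (coord_algebra {..j - 1}) (indicator {x. x j = a}) x
                       = g a (past j x))"

definition g_measure ::
  "('a::finite \<Rightarrow> (nat \<Rightarrow> 'a) \<Rightarrow> real) \<Rightarrow> (int \<Rightarrow> 'a) measure \<Rightarrow> bool" where
  "g_measure g P \<longleftrightarrow>
     prob_space P \<and> sets P = sets (coord_algebra UNIV) \<and> stationary P \<and> follows_kernel_at g P 0"

definition equilibrium_phase_transition :: "('a::finite \<Rightarrow> (nat \<Rightarrow> 'a) \<Rightarrow> real) \<Rightarrow> bool" where
  "equilibrium_phase_transition g \<longleftrightarrow> (\<exists>P Q. g_measure g P \<and> g_measure g Q \<and> P \<noteq> Q)"

text \<open>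
  For a kernel \<open>g\<close> and a past \<open>u\<close>, the two conditions below determine the probabilities of all
  cylinders, and a measure satisfying them exists by the Ionescu-Tulcea theorem; hence the
  description is definite.
\<close>

definition law_from_past ::
  "('a::finite \<Rightarrow> (nat \<Rightarrow> 'a) \<Rightarrow> real) \<Rightarrow> (nat \<Rightarrow> 'a) \<Rightarrow> (int \<Rightarrow> 'a) measure" where
  "law_from_past g u =
     (THE P. prob_space P \<and> sets P = sets (coord_algebra UNIV) \<and>
             (AE x in P. past 0 x = u) \<and> (\<forall>j\<ge>0. follows_kernel_at g P j))"

definition dynamic_uniqueness :: "('a::finite \<Rightarrow> (nat \<Rightarrow> 'a) \<Rightarrow> real) \<Rightarrow> bool" where
  "dynamic_uniqueness g \<longleftrightarrow>
     (\<forall>A\<in>tail_events. \<forall>u v. measure (law_from_past g u) A = measure (law_from_past g v) A)"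

definition dynamic_phase_transition :: "('a::finite \<Rightarrow> (nat \<Rightarrow> 'a) \<Rightarrow> real) \<Rightarrow> bool" where
  "dynamic_phase_transition g \<longleftrightarrow> \<not> dynamic_uniqueness g"

end

theory Submission
  imports Defs
begin

text \<open>
  Under dynamic uniqueness the law started from a past does not depend on that past on tail events;
  as a measure following the kernel restricted to the future is the mixture of these laws over its
  own pasts, any two \<open>g\<close>-measures \<open>P\<close>, \<open>Q\<close> agree on the tail. Two stationary measures that agree
  on the tail are equal. Given a future event \<open>C\<close>, consider for each \<open>n\<close> the \<open>[0,1]\<close>-valued functions
  of the coordinates from \<open>n\<close> on with \<open>P\<close>-mean \<open>P C\<close> and \<open>Q\<close>-mean \<open>Q C\<close>; by stationarity the
  indicator of the \<open>n\<close>-th translate of \<open>C\<close> is one. By the parallelogram identity, functions nearly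
  minimising the sum of the two squared \<open>L\<^sup>2\<close>-norms converge almost surely for both measures. The limit
  is tail measurable, and comparing its two means gives \<open>P C = Q C\<close>.
\<close>

subsection \<open>Measures agreeing on the tail of a decreasing filtration\<close>

text \<open>With weights \<open>2 ^ n\<close> the squared increments still have means at most
  \<open>(1 / 2) ^ n\<close>, so their weighted sum is almost surely finite. By an elementary
  quadratic inequality this makes the increments themselves absolutely summable.\<close>

lemma (in prob_space) AE_convergent_of_square_increments:
  fixes f :: "nat \<Rightarrow> 'a \<Rightarrow> real"
  assumes [measurable]: "\<And>n. f n \<in> borel_measurable M"
    and bounded: "\<And>n x. f n x \<in> {0..1}"
    and increments: "\<And>n. (\<integral>x. (f (Suc n) x - f n x)\<^sup>2 \<partial>M) \<le> (1 / 4) ^ n"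
  shows "AE x in M. convergent (\<lambda>n. f n x)"
proof -
  define h where "h n x = 2 ^ n * (f (Suc n) x - f n x)\<^sup>2" for n x
  have [measurable]: "h n \<in> borel_measurable M" for n
    unfolding h_def by measurable
  have h_nonneg: "0 \<le> h n x" for n x
    by (simp add: h_def)
  have "(f (Suc n) x - f n x)\<^sup>2 \<le> 1\<^sup>2" for n x
    using bounded[of n x] bounded[of "Suc n" x] by (intro power2_le_iff_abs_le[THEN iffD2]) auto
  then have integrable_h: "integrable M (h n)" for n
    unfolding h_def
    by (intro integrable_mult_right integrable_const_bound[where B=1]) auto
  have "(\<integral>x. h n x \<partial>M) \<le> (1 / 2) ^ n" for n
  proof -
    have "(\<integral>x. h n x \<partial>M) \<le> 2 ^ n * (1 / 4) ^ n"
      using increments[of n] by (simp add: h_def)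
    also have "\<dots> = (1 / 2) ^ n"
      by (simp flip: power_mult_distrib)
    finally show ?thesis .
  qed
  then have "(\<integral>\<^sup>+x. ennreal (h n x) \<partial>M) \<le> ennreal ((1 / 2) ^ n)" for n
    using integrable_h h_nonneg by (subst nn_integral_eq_integral) (auto intro: ennreal_leI)
  then have "(\<Sum>n. \<integral>\<^sup>+x. ennreal (h n x) \<partial>M) \<le> (\<Sum>n. ennreal ((1 / 2) ^ n))"
    by (intro suminf_le) auto
  also have "\<dots> < \<infinity>"
    by (subst suminf_ennreal2) (auto intro: summable_geometric)
  finally have "(\<integral>\<^sup>+x. (\<Sum>n. ennreal (h n x)) \<partial>M) \<noteq> \<infinity>"
    by (subst nn_integral_suminf) auto
  then have "AE x in M. (\<Sum>n. ennreal (h n x)) \<noteq> \<infinity>"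
    by (intro nn_integral_noteq_infinite) auto
  then show ?thesis
  proof eventually_elim
    case (elim x)
    then have "summable (\<lambda>n. h n x)"
      using h_nonneg by (intro summable_suminf_not_top) auto
    then have "summable (\<lambda>n. (1 / 2) ^ n + h n x)"
      by (intro summable_add summable_geometric) auto
    moreover have "norm (f (Suc n) x - f n x) \<le> (1 / 2) ^ n + h n x" for n
    proof -
      \<comment> \<open>Expanding the square gives
        \<open>t * d \<le> 1 + t\<^sup>2 * d\<^sup>2\<close>; division by the weight
        \<open>t\<close> bounds the increment by a geometric term plus the summable weighted
        square.\<close>
      define t :: real and d where "t = 2 ^ n" and "d = \<bar>f (Suc n) x - f n x\<bar>"
      have "t > 0" by (simp add: t_def)
      have "0 \<le> (t * d - 1)\<^sup>2 + t * d"
        using \<open>t > 0\<close> by (simp add: d_def)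
      then have "t * d \<le> 1 + t\<^sup>2 * d\<^sup>2"
        by (simp add: power2_eq_square algebra_simps)
      then have "d \<le> 1 / t + t * d\<^sup>2"
        using \<open>t > 0\<close> by (simp add: field_simps power2_eq_square)
      then show ?thesis
        by (simp add: h_def t_def d_def power_one_over)
    qed
    ultimately have "summable (\<lambda>n. f (Suc n) x - f n x)"
      by (auto intro: summable_comparison_test'[where N=0 and g="\<lambda>n. (1 / 2) ^ n + h n x"])
    then have "convergent (\<lambda>n. \<Sum>i<n. f (Suc i) x - f i x)"
      by (simp add: summable_iff_convergent)
    then have "convergent (\<lambda>n. (\<Sum>i<n. f (Suc i) x - f i x) + f 0 x)"
      by (intro convergent_add convergent_const)
    then show ?case
      by (simp add: sum_lessThan_telescope[of "\<lambda>n. f n x"])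
  qed
qed

text \<open>This is the projection argument of Hilbert space theory along a decreasing sequence of
  midpoint-closed sets: two points that nearly minimise \<open>N\<close> are close, since their
  midpoint cannot do much better. \<open>N\<close> and \<open>D\<close> are left abstract so that
  the sum of two squared norms can be inserted.\<close>

lemma near_minimisers_of_midpoint_closed:
  fixes N :: "'b \<Rightarrow> real" and D :: "'b \<Rightarrow> 'b \<Rightarrow> real" and G :: "nat \<Rightarrow> 'b set"
  assumes parallelogram: "\<And>n f g. f \<in> G n \<Longrightarrow> g \<in> G n \<Longrightarrow> D f g = 2 * N f + 2 * N g - 4 * N (mid f g)"
    and midpoint: "\<And>n f g. f \<in> G n \<Longrightarrow> g \<in> G n \<Longrightarrow> mid f g \<in> G n"
    and decreasing: "decseq G"
    and nonempty: "\<And>n. G n \<noteq> {}"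
    and bounded: "\<And>n f. f \<in> G n \<Longrightarrow> N f \<in> {0..B}"
    and pos: "\<And>n. \<delta> n > 0" and dec: "decseq \<delta>"
  shows "\<exists>f. \<forall>n. f n \<in> G n \<and> D (f (Suc n)) (f n) \<le> \<delta> n"
proof -
  define d where "d n = (INF f\<in>G n. N f)" for n
  have bdd: "bdd_below (N ` G n)" for n
    using bounded by (auto intro!: bdd_belowI[of _ 0])
  have d_le: "d n \<le> N f" if "f \<in> G n" for n f
    unfolding d_def using that bdd by (intro cINF_lower) auto
  have "incseq d"
    unfolding d_def incseq_def
    using decseqD[OF decreasing] bdd nonempty by (auto intro!: cINF_superset_mono)
  have d_le_B: "d n \<le> B" for n
    using nonempty[of n] d_le bounded by (fastforce intro: order_trans)
  obtain L where L: "d \<longlonglongrightarrow> L" "\<And>n. d n \<le> L"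
    using incseq_convergent[OF \<open>incseq d\<close>] d_le_B by metis
  have "\<exists>K. \<forall>k\<ge>K. L - \<delta> n / 8 < d k" for n
    using order_tendstoD(1)[OF L(1), of "L - \<delta> n / 8"] pos[of n]
    by (auto simp: eventually_sequentially)
  then obtain K where K: "\<And>n k. k \<ge> K n \<Longrightarrow> L - \<delta> n / 8 < d k"
    by metis
  \<comment> \<open>\<open>K n\<close> makes the infimum nearly equal to its limit \<open>L\<close>;
    the maximum with \<open>n\<close> keeps the chosen point inside \<open>G n\<close>.\<close>
  define k where "k n = max n (K n)" for n
  have "\<exists>f\<in>G (k n). N f < d (k n) + \<delta> n / 8" for n
    using cInf_lessD[of "N ` G (k n)" "d (k n) + \<delta> n / 8"] nonempty[of "k n"] pos[of n]
    by (auto simp: d_def)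
  then obtain f where f: "\<And>n. f n \<in> G (k n)" "\<And>n. N (f n) < d (k n) + \<delta> n / 8"
    by metis
  have f_G: "f n \<in> G n" for n
    using f(1)[of n] decseqD[OF decreasing, of n "k n"] by (auto simp: k_def)
  have "D (f (Suc n)) (f n) \<le> \<delta> n" for n
  proof -
    \<comment> \<open>Nothing orders \<open>k n\<close> and \<open>k (Suc n)\<close>, so both points
      are placed in the larger set \<open>G m\<close>. Their norms are below
      \<open>L + \<delta> n / 8\<close> and that of the midpoint is above
      \<open>L - \<delta> n / 8\<close>, which the parallelogram identity turns into four times
      \<open>\<delta> n / 4\<close>.\<close>
    define m where "m = min (k n) (k (Suc n))"
    have \<delta>_Suc: "\<delta> (Suc n) \<le> \<delta> n"
      using dec by (simp add: decseq_Suc_iff)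
    have m: "L - \<delta> n / 8 < d m"
      using K[of n m] K[of "Suc n" m] \<delta>_Suc
      by (cases "k n \<le> k (Suc n)") (auto simp: m_def k_def min_def)
    have *: "f n \<in> G m" "f (Suc n) \<in> G m"
      using f(1)[of n] f(1)[of "Suc n"] decseqD[OF decreasing, of m "k n"]
        decseqD[OF decreasing, of m "k (Suc n)"] by (auto simp: m_def)
    have "d m \<le> N (mid (f (Suc n)) (f n))"
      by (intro d_le midpoint *)
    moreover have "N (f n) < L + \<delta> n / 8" "N (f (Suc n)) < L + \<delta> n / 8"
      using f(2)[of n] f(2)[of "Suc n"] L(2)[of "k n"] L(2)[of "k (Suc n)"] \<delta>_Suc by auto
    ultimately show ?thesis
      using parallelogram[OF *(2,1)] m by simp
  qed
  with f_G show ?thesis by blast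
qed

lemma integral_parallelogram:
  fixes f g :: "'b \<Rightarrow> real"
  assumes "integrable M (\<lambda>x. f x * f x)" "integrable M (\<lambda>x. f x * g x)" "integrable M (\<lambda>x. g x * g x)"
  shows "(\<integral>x. (f x - g x)\<^sup>2 \<partial>M) =
    2 * (\<integral>x. (f x)\<^sup>2 \<partial>M) + 2 * (\<integral>x. (g x)\<^sup>2 \<partial>M) - 4 * (\<integral>x. ((f x + g x) / 2)\<^sup>2 \<partial>M)"
proof -
  have eq: "(f x - g x)\<^sup>2 = f x * f x - 2 * (f x * g x) + g x * g x"
       "((f x + g x) / 2)\<^sup>2 = f x * f x / 4 + f x * g x / 2 + g x * g x / 4" for x
    by (simp_all add: power2_eq_square algebra_simps add_divide_distrib)
  show ?thesis
    unfolding eq using assms by (simp add: power2_eq_square)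
qed

text \<open>Minimising the two squared norms together yields one sequence that converges almost
  surely under \<open>P\<close> and under \<open>Q\<close>. Hence a single tail measurable limit
  carries both means, whereas conditional expectations taken separately under \<open>P\<close> and
  \<open>Q\<close> could be different functions.\<close>

lemma limit_integral_eq_of_agree_on_tail:
  fixes F :: "nat \<Rightarrow> 'b measure" and p q :: real
  assumes P: "prob_space P" and Q: "prob_space Q"
    and subalgebra: "\<And>n. subalgebra P (F n)" "\<And>n. subalgebra Q (F n)"
    and decreasing: "decseq (\<lambda>n. sets (F n))"
    and agree: "\<And>A. (\<And>n. A \<in> sets (F n)) \<Longrightarrow> measure P A = measure Q A"
    and approx: "\<And>n. \<exists>f\<in>borel_measurable (F n).
        (\<forall>x. f x \<in> {0..1}) \<and> (\<integral>x. f x \<partial>P) = p \<and> (\<integral>x. f x \<partial>Q) = q"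
  shows "p = q"
proof -
  interpret P: prob_space P by fact
  interpret Q: prob_space Q by fact
  define G where "G n = {f \<in> borel_measurable (F n).
      (\<forall>x. f x \<in> {0..1}) \<and> (\<integral>x. f x \<partial>P) = p \<and> (\<integral>x. f x \<partial>Q) = q}" for n
  define N where "N f = (\<integral>x. (f x)\<^sup>2 \<partial>P) + (\<integral>x. (f x)\<^sup>2 \<partial>Q)" for f :: "'b \<Rightarrow> real"
  have space_F: "space (F n) = space P" "space (F n) = space Q" for n
    using subalgebra by (auto simp: subalgebra_def)
  have G_meas: "f \<in> borel_measurable P" "f \<in> borel_measurable Q" if "f \<in> G n" for f n
    using that measurable_from_subalg[OF subalgebra(1)[of n]]
      measurable_from_subalg[OF subalgebra(2)[of n]] by (auto simp: G_def)
  have G_bounds: "0 \<le> f x" "f x \<le> 1" if "f \<in> G n" for f n x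
    using that by (auto simp: G_def)
  have int_P: "integrable P (\<lambda>x. f x * g x)" and int_Q: "integrable Q (\<lambda>x. f x * g x)"
    and int1_P: "integrable P f" and int1_Q: "integrable Q f"
    if "f \<in> G n" "g \<in> G n" for f g :: "'b \<Rightarrow> real" and n
  proof -
    have "\<bar>f x * g x\<bar> \<le> 1" "\<bar>f x\<bar> \<le> 1" for x
      using G_bounds[OF that(1), of x] G_bounds[OF that(2), of x] by (auto simp: abs_mult mult_le_one)
    moreover note [measurable] = G_meas[OF that(1)] G_meas[OF that(2)]
    ultimately show "integrable P (\<lambda>x. f x * g x)" "integrable Q (\<lambda>x. f x * g x)"
        "integrable P f" "integrable Q f"
      by (intro P.integrable_const_bound[where B=1] Q.integrable_const_bound[where B=1]; simp)+
  qed
  have N_minus: "N (\<lambda>x. f x - g x) = 2 * N f + 2 * N g - 4 * N (\<lambda>x. (f x + g x) / 2)"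
    if "f \<in> G n" "g \<in> G n" for f g n
    using integral_parallelogram[OF int_P[OF that(1,1)] int_P[OF that] int_P[OF that(2,2)]]
      integral_parallelogram[OF int_Q[OF that(1,1)] int_Q[OF that] int_Q[OF that(2,2)]]
    by (simp add: N_def)
  have G_mid: "(\<lambda>x. (f x + g x) / 2) \<in> G n" if "f \<in> G n" "g \<in> G n" for f g n
  proof -
    have "(f x + g x) / 2 \<in> {0..1}" for x
      using G_bounds[OF that(1), of x] G_bounds[OF that(2), of x] by simp
    then show ?thesis
      using that int1_P[OF that] int1_Q[OF that] int1_P[OF that(2,1)] int1_Q[OF that(2,1)]
      by (auto simp: G_def)
  qed
  have "decseq G"
  proof (rule decseq_SucI, rule subsetI)
    fix n f assume "f \<in> G (Suc n)"
    moreover have "subalgebra (F n) (F (Suc n))"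
      using decseqD[OF decreasing, of n "Suc n"] space_F by (simp add: subalgebra_def)
    ultimately show "f \<in> G n"
      using measurable_from_subalg by (auto simp: G_def)
  qed
  have "\<exists>f. \<forall>n. f n \<in> G n \<and> N (\<lambda>x. f (Suc n) x - f n x) \<le> (1 / 4) ^ n"
  proof (rule near_minimisers_of_midpoint_closed[where N=N and mid="\<lambda>f g x. (f x + g x) / 2" and B=2])
    show "G n \<noteq> {}" for n
      using approx[of n] by (auto simp: G_def)
    show "N f \<in> {0..2}" if "f \<in> G n" for n f
    proof -
      have "(\<integral>x. f x * f x \<partial>P) \<le> 1" "(\<integral>x. f x * f x \<partial>Q) \<le> 1"
        using int_P[OF that that] int_Q[OF that that] G_bounds[OF that]
        by (intro P.integral_le_const Q.integral_le_const AE_I2 mult_le_one; simp)+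
      then show ?thesis
        by (auto simp: N_def power2_eq_square)
    qed
    show "decseq (\<lambda>n. (1 / 4 :: real) ^ n)"
      by (auto simp: decseq_Suc_iff)
  qed (use N_minus G_mid \<open>decseq G\<close> in auto)
  then obtain f where f: "\<And>n. f n \<in> G n"
      and incr: "\<And>n. N (\<lambda>x. f (Suc n) x - f n x) \<le> (1 / 4) ^ n"
    by metis
  note [measurable] = G_meas[OF f]
  note bounds = G_bounds[OF f]
  define l where "l x = lim (\<lambda>n. f n x)" for x
  \<comment> \<open>At a point of divergence \<open>lim\<close> is an unspecified value, but one
    determined by the set of limits alone. That set is unchanged by dropping the first
    \<open>m\<close> terms, so \<open>l\<close> is the \<open>lim\<close> of every shifted sequence
    at every point, and therefore measurable for every \<open>F m\<close>.\<close>
  have "(\<lambda>n. f n x) \<longlonglongrightarrow> a \<longleftrightarrow> (\<lambda>n. f (n + m) x) \<longlonglongrightarrow> a" for m x a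
    using LIMSEQ_ignore_initial_segment[of "\<lambda>n. f n x" a m] LIMSEQ_offset[of "\<lambda>n. f n x" m a] by blast
  then have l_shift: "l = (\<lambda>x. lim (\<lambda>n. f (n + m) x))" for m
    unfolding l_def lim_def by simp
  have l_meas: "l \<in> borel_measurable (F m)" for m
  proof -
    have "f (n + m) \<in> borel_measurable (F m)" for n
      using f[of "n + m"] decseqD[OF \<open>decseq G\<close>, of m "n + m"] by (auto simp: G_def)
    then show ?thesis
      unfolding l_shift[of m] by (intro borel_measurable_lim_metric)
  qed
  have limit: "(\<integral>x. l x \<partial>R) = r"
    if R: "prob_space R" and [measurable]: "\<And>n. f n \<in> borel_measurable R"
      and r: "\<And>n. (\<integral>x. f n x \<partial>R) = r"
      and inc: "\<And>n. (\<integral>x. (f (Suc n) x - f n x)\<^sup>2 \<partial>R) \<le> (1 / 4) ^ n" for R r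
  proof -
    interpret R: prob_space R by fact
    have "AE x in R. convergent (\<lambda>n. f n x)"
      using bounds inc by (intro R.AE_convergent_of_square_increments) auto
    then have "AE x in R. (\<lambda>n. f n x) \<longlonglongrightarrow> l x"
      by (simp add: convergent_LIMSEQ_iff l_def)
    then have "(\<lambda>n. \<integral>x. f n x \<partial>R) \<longlonglongrightarrow> (\<integral>x. l x \<partial>R)"
      using bounds
      by (intro integral_dominated_convergence[where w="\<lambda>_. 1"]) (auto simp: l_def)
    then show ?thesis
      by (simp add: r LIMSEQ_const_iff)
  qed
  have "(\<integral>x. (f (Suc n) x - f n x)\<^sup>2 \<partial>P) \<le> (1 / 4) ^ n"
      "(\<integral>x. (f (Suc n) x - f n x)\<^sup>2 \<partial>Q) \<le> (1 / 4) ^ n" for n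
  proof -
    have "0 \<le> (\<integral>x. (f (Suc n) x - f n x)\<^sup>2 \<partial>P)" "0 \<le> (\<integral>x. (f (Suc n) x - f n x)\<^sup>2 \<partial>Q)"
      by simp_all
    with incr[of n] show "(\<integral>x. (f (Suc n) x - f n x)\<^sup>2 \<partial>P) \<le> (1 / 4) ^ n"
        "(\<integral>x. (f (Suc n) x - f n x)\<^sup>2 \<partial>Q) \<le> (1 / 4) ^ n"
      unfolding N_def by linarith+
  qed
  moreover have "(\<integral>x. f n x \<partial>P) = p" "(\<integral>x. f n x \<partial>Q) = q" for n
    using f[of n] by (auto simp: G_def)
  ultimately have "(\<integral>x. l x \<partial>P) = p" "(\<integral>x. l x \<partial>Q) = q"
    by (auto intro: limit P Q G_meas[OF f])
  moreover have "(\<integral>x. l x \<partial>P) = (\<integral>x. l x \<partial>Q)"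
  proof -
    \<comment> \<open>\<open>T\<close> turns the intersection of the filtration into a
      \<sigma>-algebra on which the restrictions of \<open>P\<close> and \<open>Q\<close> are the
      same measure, so the integrals of \<open>l\<close> coincide.\<close>
    define T where "T = sigma (space P) (\<Inter>n. sets (F n))"
    have "(\<Inter>n. sets (F n)) \<subseteq> Pow (space P)"
      using sets.space_closed[of "F 0"] unfolding space_F(1) by blast
    then have space_T: "space T = space P" and "sets T = sigma_sets (space P) (\<Inter>n. sets (F n))"
      unfolding T_def by (simp_all add: space_measure_of sets_measure_of)
    moreover have "sigma_sets (space P) (\<Inter>n. sets (F n)) \<subseteq> sets (F n)" for n
      using sets.sigma_sets_subset[of "\<Inter>n. sets (F n)" "F n"] unfolding space_F(1) by blast
    ultimately have sets_T: "sets T = (\<Inter>n. sets (F n))"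
      by blast
    have T: "subalgebra P T" "subalgebra Q T"
      using subalgebra sets_T space_T space_F by (fastforce simp: subalgebra_def)+
    have "l -` B \<inter> space T \<in> sets T" if "B \<in> sets borel" for B
      using measurable_sets[OF l_meas that] by (simp add: sets_T space_T space_F(1))
    then have l_T: "l \<in> borel_measurable T"
      by (simp add: measurable_def)
    have "restr_to_subalg P T = restr_to_subalg Q T"
    proof (rule measure_eqI)
      fix A assume "A \<in> sets (restr_to_subalg P T)"
      then show "emeasure (restr_to_subalg P T) A = emeasure (restr_to_subalg Q T) A"
        using T agree[of A] sets_T
        by (simp add: sets_restr_to_subalg emeasure_restr_to_subalg
            P.emeasure_eq_measure Q.emeasure_eq_measure)
    qed (simp add: sets_restr_to_subalg T)
    then show ?thesis
      by (metis integral_subalgebra2 T l_T)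
  qed
  ultimately show ?thesis by simp
qed

subsection \<open>Coordinates, pasts and words\<close>

abbreviation past_space :: "(nat \<Rightarrow> 'a) measure" where
  "past_space \<equiv> Pi\<^sub>M UNIV (\<lambda>_. count_space UNIV)"

text \<open>The latest symbol comes first, as in a past: moving one step ahead in time is a cons,
  and the past at time \<open>n\<close> is this word concatenated with the past at time 0.\<close>

primrec recent :: "nat \<Rightarrow> (int \<Rightarrow> 'a) \<Rightarrow> 'a list" where
  "recent 0 x = []"
| "recent (Suc n) x = x (int n) # recent n x"

definition cylinder :: "'a list \<Rightarrow> (int \<Rightarrow> 'a) set" where
  "cylinder w = {x. recent (length w) x = w}"

definition time_shift :: "nat \<Rightarrow> (int \<Rightarrow> 'a) \<Rightarrow> int \<Rightarrow> 'a" where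
  "time_shift n x i = x (i + int n)"

lemma length_recent [simp]: "length (recent n x) = n"
  by (induction n) auto

lemma drop_recent: "drop k (recent (k + n) x) = recent n x"
  by (induction k) auto

lemma nth_recent: "i < n \<Longrightarrow> recent n x ! i = x (int n - 1 - int i)"
  by (induction n arbitrary: i) (auto simp: nth_Cons intro!: arg_cong[of _ _ x] split: nat.split)

lemma past_eq_conc: "past (int n) x = recent n x \<frown> past 0 x"
  by (rule ext) (auto simp: past_def conc_def nth_recent of_nat_diff intro!: arg_cong[of _ _ x])

lemma past_0_time_shift: "past 0 (time_shift n x) = past (int n) x"
  by (auto simp: past_def time_shift_def algebra_simps)

lemma space_coord_algebra [simp]: "space (coord_algebra I) = UNIV"
  by (simp add: coord_algebra_def space_measure_of_conv)

lemma measurable_coord: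
  fixes i :: int
  assumes "i \<in> I"
  shows "(\<lambda>x. x i) \<in> measurable (coord_algebra I) (count_space (UNIV :: 'a::finite set))"
proof (rule measurable_count_space_eq2_countable[THEN iffD2])
  have "{x. x i = a} \<in> sets (coord_algebra I)" for a :: 'a
    using assms by (auto simp: coord_algebra_def intro: sigma_sets.Basic)
  then show "(\<lambda>x. x i) \<in> space (coord_algebra I) \<rightarrow> UNIV \<and>
      (\<forall>a\<in>(UNIV :: 'a set). (\<lambda>x. x i) -` {a} \<inter> space (coord_algebra I) \<in> sets (coord_algebra I))"
    by (auto simp: vimage_def)
qed

lemma measurable_coord_algebraI:
  fixes f :: "'b \<Rightarrow> int \<Rightarrow> 'a::finite"
  assumes "\<And>i. i \<in> I \<Longrightarrow> (\<lambda>x. f x i) \<in> measurable M (count_space UNIV)"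
  shows "f \<in> measurable M (coord_algebra I)"
  unfolding coord_algebra_def
proof (rule measurable_measure_of)
  fix A :: "(int \<Rightarrow> 'a) set" assume "A \<in> {{x. x i = a} |i a. i \<in> I}"
  then obtain i a where "A = {x. x i = a}" "i \<in> I"
    by auto
  then show "f -` A \<inter> space M \<in> sets M"
    using measurable_sets[OF assms[OF \<open>i \<in> I\<close>], of "{a}"] by (simp add: vimage_def)
qed auto

lemma sets_coord_algebra_mono:
  assumes "I \<subseteq> J"
  shows "sets (coord_algebra I :: (int \<Rightarrow> 'a::finite) measure) \<subseteq> sets (coord_algebra J)"
proof -
  have "(\<lambda>x. x) \<in> measurable (coord_algebra J) (coord_algebra I :: (int \<Rightarrow> 'a) measure)"
    using assms by (intro measurable_coord_algebraI measurable_coord) auto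
  from measurable_sets[OF this] show ?thesis by auto
qed

lemma measurable_past:
  assumes "{..j - 1} \<subseteq> I"
  shows "past j \<in> measurable (coord_algebra I) (past_space :: (nat \<Rightarrow> 'a::finite) measure)"
  unfolding past_def using assms
  by (intro measurable_PiM_single' measurable_coord) auto

lemma measurable_time_shift:
  assumes "\<And>i. i \<in> I \<Longrightarrow> i + int n \<in> J"
  shows "time_shift n \<in> measurable (coord_algebra J) (coord_algebra I :: (int \<Rightarrow> 'a::finite) measure)"
  unfolding time_shift_def using assms
  by (intro measurable_coord_algebraI measurable_coord)

lemma measurable_recent:
  assumes "{0..<int n} \<subseteq> I"
  shows "recent n \<in> measurable (coord_algebra I) (count_space (UNIV :: 'a::finite list set))"
  using assms
proof (induction n)
  case (Suc n)
  then have "{0..<int n} \<subseteq> I"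
    by (auto simp: subset_iff)
  note [measurable] = Suc.IH[OF this]
  have [measurable]: "(\<lambda>x. x (int n)) \<in> measurable (coord_algebra I) (count_space (UNIV :: 'a set))"
    using Suc.prems by (intro measurable_coord) auto
  show ?case
    unfolding recent.simps by measurable
qed (subst measurable_cong[of _ _ "\<lambda>_. []"], auto)

lemma cylinder_in_sets:
  assumes "{0..<int (length w)} \<subseteq> I"
  shows "cylinder w \<in> sets (coord_algebra I :: (int \<Rightarrow> 'a::finite) measure)"
  using measurable_sets[OF measurable_recent[OF assms], of "{w}"]
  by (simp add: cylinder_def vimage_def)

lemma measurable_conc [measurable]:
  "(\<lambda>u. w \<frown> u) \<in> measurable past_space (past_space :: (nat \<Rightarrow> 'a) measure)"
  unfolding conc_def
  by (rule measurable_PiM_single') auto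

lemma measurable_suffix [measurable]:
  "suffix n \<in> measurable past_space (past_space :: (nat \<Rightarrow> 'a) measure)"
  unfolding suffix_def
  by (rule measurable_PiM_single') auto

lemma measurable_prefix [measurable]:
  "prefix n \<in> measurable past_space (count_space (UNIV :: 'a::finite list set))"
proof (induction n)
  case (Suc n)
  note [measurable] = this
  show ?case
    unfolding subseq_to_Suc[OF le0] by measurable
qed (simp add: subsequence_def)

section \<open>Cylinders as a generator of the future\<close>

lemma Int_stable_cylinders: "Int_stable (insert {} (range cylinder))"
proof -
  \<comment> \<open>All cylinders start at time 0, so two of them are nested or disjoint: dropping
    the latest symbols of the longer word leaves a word that either is the shorter one or
    contradicts it. The second case is why the empty set is added.\<close>
  have "cylinder w \<inter> cylinder v \<in> insert {} (range cylinder)"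
    if "length w \<le> length v" for w v :: "'a list"
  proof -
    have "recent (length w) x = drop (length v - length w) v" if "recent (length v) x = v" for x
      using drop_recent[of "length v - length w" "length w" x] that \<open>length w \<le> length v\<close> by simp
    then have "cylinder w \<inter> cylinder v = (if drop (length v - length w) v = w then cylinder v else {})"
      unfolding cylinder_def by auto
    then show ?thesis by auto
  qed
  then have "cylinder w \<inter> cylinder v \<in> insert {} (range cylinder)" for w v :: "'a list"
    by (metis Int_commute nle_le)
  then show ?thesis
    unfolding Int_stable_def by blast
qed

lemma sets_future_subset:
  "sets (coord_algebra {0..} :: (int \<Rightarrow> 'a::finite) measure)
    \<subseteq> sigma_sets UNIV (insert {} (range cylinder))"
proof -
  let ?S = "sigma (UNIV :: (int \<Rightarrow> 'a) set) (insert {} (range cylinder))"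
  have "(\<lambda>x. x) \<in> measurable ?S (coord_algebra {0..})"
  proof (rule measurable_coord_algebraI)
    fix i :: int assume "i \<in> {0..}"
    then obtain n where n: "i = int n"
      using nonneg_int_cases by auto
    have "{x. x i = a} \<in> sets ?S" for a
    proof -
      \<comment> \<open>The head of a word of length \<open>Suc n\<close> is its latest symbol, the
        one at time \<open>n\<close>.\<close>
      have "{x. x i = a} = (\<Union>w\<in>{w. length w = Suc n \<and> hd w = a}. cylinder w)"
        unfolding cylinder_def n by auto
      also have "\<dots> \<in> sets ?S"
        by (intro sets.countable_UN') (auto intro: sigma_sets.Basic)
      finally show ?thesis .
    qed
    then show "(\<lambda>x. x i) \<in> measurable ?S (count_space UNIV)"
      by (subst measurable_count_space_eq2_countable) (auto simp: vimage_def space_measure_of_conv)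
  qed
  from measurable_sets[OF this] show ?thesis
    by (auto simp: space_measure_of_conv)
qed

text \<open>The mixture formula extends from cylinders by the \<pi>-\<lambda> theorem. It serves
  twice: with a constant \<open>K\<close> it says that cylinder probabilities determine a measure on
  the future, and with \<open>K\<close> the law started from the past at time 0 it decomposes a
  \<open>g\<close>-measure.\<close>

lemma mixture_on_future:
  fixes P :: "(int \<Rightarrow> 'a::finite) measure" and K :: "'b \<Rightarrow> (int \<Rightarrow> 'a) measure"
  assumes R: "prob_space R"
    and P: "prob_space P" "sets P = sets (coord_algebra UNIV)"
    and K: "\<And>y. prob_space (K y)" "\<And>y. sets (K y) = sets (coord_algebra UNIV)"
    and meas: "\<And>w. (\<lambda>y. measure (K y) (cylinder w)) \<in> borel_measurable R"
    and mix: "\<And>w. measure P (cylinder w) = (\<integral>y. measure (K y) (cylinder w) \<partial>R)"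
    and A: "A \<in> sets (coord_algebra {0..})"
  shows "measure P A = (\<integral>y. measure (K y) A \<partial>R)"
proof -
  interpret R: prob_space R by fact
  interpret P: prob_space P by fact
  interpret K: prob_space "K y" for y by fact
  have [simp]: "space P = UNIV" "space (K y) = UNIV" for y
    using sets_eq_imp_space_eq[OF P(2)] sets_eq_imp_space_eq[OF K(2)] by auto
  have G_sets: "B \<in> sets (coord_algebra UNIV)"
    if "B \<in> sigma_sets UNIV (insert {} (range cylinder))" for B :: "(int \<Rightarrow> 'a) set"
  proof -
    have "insert {} (range cylinder) \<subseteq> sets (coord_algebra UNIV :: (int \<Rightarrow> 'a) measure)"
      by (auto intro: cylinder_in_sets)
    with sets.sigma_sets_subset[OF this] that show ?thesis
      by auto
  qed
  have "insert {} (range cylinder) \<subseteq> Pow UNIV" "A \<in> sigma_sets UNIV (insert {} (range cylinder))"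
    using A sets_future_subset by auto
  \<comment> \<open>Measurability in \<open>y\<close> is part of the induction claim because the
    complement and union cases integrate it. Working with \<open>emeasure\<close> lets countable
    sums pass through the integral freely.\<close>
  with Int_stable_cylinders have "(\<lambda>y. emeasure (K y) A) \<in> borel_measurable R \<and>
      emeasure P A = (\<integral>\<^sup>+y. emeasure (K y) A \<partial>R)"
  proof (induction rule: sigma_sets_induct_disjoint)
    case (basic B)
    then consider "B = {}" | w where "B = cylinder w" by auto
    then show ?case
    proof cases
      case 2
      have "integrable R (\<lambda>y. measure (K y) B)"
        using meas 2 by (intro R.integrable_const_bound[where B=1]) auto
      then have "(\<integral>\<^sup>+y. emeasure (K y) B \<partial>R) = ennreal (\<integral>y. measure (K y) B \<partial>R)"
        by (simp add: K.emeasure_eq_measure nn_integral_eq_integral)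
      then show ?thesis
        using meas mix 2 by (simp add: K.emeasure_eq_measure P.emeasure_eq_measure)
    qed simp
  next
    case empty
    show ?case by simp
  next
    case (compl B)
    have [measurable]: "(\<lambda>y. emeasure (K y) B) \<in> borel_measurable R"
      using compl.IH by blast
    have eq: "emeasure (K y) (UNIV - B) = 1 - emeasure (K y) B" for y
      using emeasure_compl[of B "K y"] G_sets[OF compl.hyps] K(2) K.emeasure_space_1[of y] by simp
    have "emeasure P (UNIV - B) = 1 - emeasure P B"
      using emeasure_compl[of B P] G_sets[OF compl.hyps] P(2) P.emeasure_space_1 by simp
    also have "\<dots> = (\<integral>\<^sup>+y. 1 - emeasure (K y) B \<partial>R)"
      using compl.IH R.emeasure_space_1 K.measure_le_1
      by (subst nn_integral_diff) (auto simp: P.emeasure_eq_measure)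
    finally show ?case
      unfolding eq by simp
  next
    case (union B)
    have [measurable]: "(\<lambda>y. emeasure (K y) (B i)) \<in> borel_measurable R" for i
      using union.IH by blast
    have eq: "emeasure (K y) (\<Union>i. B i) = (\<Sum>i. emeasure (K y) (B i))" for y
      using union.hyps K(2) by (intro suminf_emeasure[symmetric]) (auto intro!: G_sets)
    have "emeasure P (\<Union>i. B i) = (\<Sum>i. emeasure P (B i))"
      using union.hyps P(2) by (intro suminf_emeasure[symmetric]) (auto intro!: G_sets)
    also have "\<dots> = (\<integral>\<^sup>+y. (\<Sum>i. emeasure (K y) (B i)) \<partial>R)"
      using union.IH by (subst nn_integral_suminf) auto
    finally show ?case
      unfolding eq by simp
  qed
  then have *: "(\<lambda>y. emeasure (K y) A) \<in> borel_measurable R"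
      "emeasure P A = (\<integral>\<^sup>+y. emeasure (K y) A \<partial>R)"
    by auto
  then have "(\<lambda>y. measure (K y) A) \<in> borel_measurable R"
    unfolding measure_def by measurable
  then have "integrable R (\<lambda>y. measure (K y) A)"
    by (intro R.integrable_const_bound[where B=1]) auto
  then show ?thesis
    using *(2) by (simp add: K.emeasure_eq_measure P.emeasure_eq_measure nn_integral_eq_integral)
qed

subsection \<open>Processes following a kernel\<close>

text \<open>The chain rule for the probability of reading \<open>w\<close> from time 0 on after the
  past \<open>u\<close>. The head is the latest symbol, so it is conditioned on the rest of the word
  followed by \<open>u\<close>.\<close>

primrec word_weight :: "('a \<Rightarrow> (nat \<Rightarrow> 'a) \<Rightarrow> real) \<Rightarrow> (nat \<Rightarrow> 'a) \<Rightarrow> 'a list \<Rightarrow> real" where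
  "word_weight g u [] = 1"
| "word_weight g u (a # w) = g a (w \<frown> u) * word_weight g u w"

lemma
  assumes "prob_kernel g"
  shows kernel_measurable [measurable (raw)]: "g a \<in> borel_measurable past_space"
    and kernel_nonneg: "0 \<le> g a u"
    and kernel_le_one: "g a u \<le> 1"
    and kernel_sum: "(\<Sum>a\<in>UNIV. g a u) = 1"
  using assms by (auto simp: prob_kernel_def)

lemma word_weight_nonneg:
  assumes "prob_kernel g"
  shows "0 \<le> word_weight g u w"
  by (induction w) (auto simp: kernel_nonneg[OF assms])

lemma word_weight_measurable:
  assumes "prob_kernel g"
  shows "(\<lambda>u. word_weight g u w) \<in> borel_measurable past_space"
proof (induction w)
  case (Cons a w)
  note [measurable] = Cons kernel_measurable[OF assms]
  show ?case
    unfolding word_weight.simps by measurable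
qed simp

text \<open>An integrated form of \<open>follows_kernel_at\<close>, tested against functions of the
  past. It mentions no conditional expectation, so a change of variables suffices to move it in
  time.\<close>

definition kernel_step ::
  "('a \<Rightarrow> (nat \<Rightarrow> 'a) \<Rightarrow> real) \<Rightarrow> (int \<Rightarrow> 'a) measure \<Rightarrow> int \<Rightarrow> bool" where
  "kernel_step g P j \<longleftrightarrow> (\<forall>a h. h \<in> borel_measurable past_space \<longrightarrow> (\<forall>u. h u \<in> {0..1}) \<longrightarrow>
     (\<integral>x. h (past j x) * indicator {x. x j = a} x \<partial>P) = (\<integral>x. h (past j x) * g a (past j x) \<partial>P))"

section \<open>Cylinder probabilities of a process following the kernel\<close>

locale process = prob_space P for P :: "(int \<Rightarrow> 'a::finite) measure" +
  assumes sets_P [simp, measurable_cong]: "sets P = sets (coord_algebra UNIV)"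
begin

lemma space_P [simp]: "space P = UNIV"
  using sets_eq_imp_space_eq[OF sets_P] by simp

lemma prob_UNIV [simp]: "prob UNIV = 1"
  using prob_space by simp

lemma integrable_unit_interval:
  fixes f :: "(int \<Rightarrow> 'a) \<Rightarrow> real"
  assumes "f \<in> borel_measurable P" and "\<And>x. f x \<in> {0..1}"
  shows "integrable P f"
  using assms by (intro integrable_const_bound[where B=1]) auto

lemma past_measurable [measurable]: "past j \<in> measurable P past_space"
  using measurable_past[of j UNIV] by (simp cong: measurable_cong_sets)

lemma coord_measurable [measurable]: "(\<lambda>x. x j) \<in> measurable P (count_space UNIV)"
  unfolding measurable_cong_sets[OF sets_P refl] by (rule measurable_coord) simp

lemma coord_event [measurable]: "{x. x j = a} \<in> sets P"
  by (auto simp: coord_algebra_def)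

lemma cylinder_event [measurable]: "cylinder w \<in> sets P"
  by (simp add: cylinder_in_sets)

lemma subalgebra_coord: "subalgebra P (coord_algebra I)"
  using sets_coord_algebra_mono[of I UNIV] by (auto simp: subalgebra_def)

lemma sigma_finite_coord: "sigma_finite_subalgebra P (coord_algebra I)"
  by (intro finite_measure_subalgebra_is_sigma_finite)
     (simp add: finite_measure_subalgebra_def finite_measure_subalgebra_axioms_def
        subalgebra_coord finite_measure_axioms)

lemma kernel_step_of_follows:
  assumes g: "prob_kernel g" and follows: "follows_kernel_at g P j"
  shows "kernel_step g P j"
  unfolding kernel_step_def
proof (intro allI impI)
  fix a and h :: "(nat \<Rightarrow> 'a) \<Rightarrow> real"
  assume h [measurable]: "h \<in> borel_measurable past_space" and bounds: "\<forall>u. h u \<in> {0..1}"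
  let ?F = "coord_algebra {..j - 1} :: (int \<Rightarrow> 'a) measure"
  interpret F: sigma_finite_subalgebra P ?F
    by (rule sigma_finite_coord)
  have [measurable]: "past j \<in> measurable ?F past_space"
    by (intro measurable_past) auto
  have "integrable P (\<lambda>x. h (past j x) * indicator {x. x j = a} x)"
  proof (rule integrable_unit_interval)
    show "h (past j x) * indicator {x. x j = a} x \<in> {0..1}" for x
      using bounds by (simp add: indicator_def)
  qed measurable
  then have "(\<integral>x. h (past j x) * indicator {x. x j = a} x \<partial>P) =
      (\<integral>x. h (past j x) * real_cond_exp P ?F (indicator {x. x j = a}) x \<partial>P)"
    by (intro F.real_cond_exp_intg(2)[symmetric]) measurable
  also have "\<dots> = (\<integral>x. h (past j x) * g a (past j x) \<partial>P)"
  proof (rule integral_cong_AE)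
    show "AE x in P. h (past j x) * real_cond_exp P ?F (indicator {x. x j = a}) x =
        h (past j x) * g a (past j x)"
      using follows unfolding follows_kernel_at_def by auto
  qed (use kernel_measurable[OF g] in measurable)
  finally show "(\<integral>x. h (past j x) * indicator {x. x j = a} x \<partial>P) =
      (\<integral>x. h (past j x) * g a (past j x) \<partial>P)" .
qed

lemma time_shift_measurable: "time_shift n \<in> measurable P P"
  using measurable_time_shift[of UNIV n UNIV] by (simp cong: measurable_cong_sets)

lemma distr_time_shift:
  assumes "stationary P"
  shows "distr P P (time_shift n) = P"
proof (induction n)
  case 0
  have "time_shift 0 = (\<lambda>x. x :: int \<Rightarrow> 'a)"
    by (simp add: time_shift_def fun_eq_iff)
  then show ?case by (simp add: distr_id)
next
  case (Suc n)
  have "time_shift (Suc n) = time_shift 1 \<circ> (time_shift n :: (int \<Rightarrow> 'a) \<Rightarrow> int \<Rightarrow> 'a)"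
    by (auto simp: time_shift_def fun_eq_iff algebra_simps)
  then have "distr P P (time_shift (Suc n)) = distr (distr P P (time_shift n)) P (time_shift 1)"
    by (simp add: distr_distr time_shift_measurable)
  also have "\<dots> = P"
    using assms unfolding Suc stationary_def by (simp add: time_shift_def[abs_def])
  finally show ?case .
qed

text \<open>A \<open>g\<close>-measure is prescribed its conditional law at time 0 only. The shift
  by \<open>n\<close> carries time 0 and its past to time \<open>n\<close> and its past, and
  stationarity leaves the integrals unchanged.\<close>

lemma kernel_step_time_shift:
  assumes g: "prob_kernel g" and "stationary P" and "kernel_step g P 0"
  shows "kernel_step g P (int n)"
  unfolding kernel_step_def
proof (intro allI impI)
  fix a and h :: "(nat \<Rightarrow> 'a) \<Rightarrow> real"
  assume h [measurable]: "h \<in> borel_measurable past_space" and bounds: "\<forall>u. h u \<in> {0..1}"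
  note [measurable] = time_shift_measurable kernel_measurable[OF g]
  have transport: "(\<integral>x. f (time_shift n x) \<partial>P) = (\<integral>x. f x \<partial>P)" if "f \<in> borel_measurable P"
    for f :: "(int \<Rightarrow> 'a) \<Rightarrow> real"
    using integral_distr[of "time_shift n" P P f] that distr_time_shift[OF \<open>stationary P\<close>, of n] by simp
  have "indicator {x. x (int n) = a} x = (indicator {x. x 0 = a} (time_shift n x) :: real)" for x :: "int \<Rightarrow> 'a"
    by (simp add: indicator_def time_shift_def)
  then have "(\<integral>x. h (past (int n) x) * indicator {x. x (int n) = a} x \<partial>P) =
      (\<integral>x. h (past 0 (time_shift n x)) * indicator {x. x 0 = a} (time_shift n x) \<partial>P)"
    by (simp add: past_0_time_shift)
  also have "\<dots> = (\<integral>x. h (past 0 x) * indicator {x. x 0 = a} x \<partial>P)"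
    by (intro transport) measurable
  also have "\<dots> = (\<integral>x. h (past 0 x) * g a (past 0 x) \<partial>P)"
    using assms(3) h bounds unfolding kernel_step_def by blast
  also have "\<dots> = (\<integral>x. h (past 0 (time_shift n x)) * g a (past 0 (time_shift n x)) \<partial>P)"
    by (intro transport[symmetric]) measurable
  finally show "(\<integral>x. h (past (int n) x) * indicator {x. x (int n) = a} x \<partial>P) =
      (\<integral>x. h (past (int n) x) * g a (past (int n) x) \<partial>P)"
    by (simp add: past_0_time_shift)
qed

text \<open>Induction on the word replaces its latest symbol by the kernel. The resulting factor
  depends only on the past at time 0 once \<open>w\<close> is fixed and is absorbed into
  \<open>h\<close>, which is why \<open>h\<close> is arbitrary in the induction.\<close>

lemma integral_cylinder:
  assumes g: "prob_kernel g" and step: "\<And>n. kernel_step g P (int n)"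
    and h: "h \<in> borel_measurable past_space" "\<And>u. h u \<in> {0..1}"
  shows "(\<integral>x. h (past 0 x) * indicator (cylinder w) x \<partial>P) =
    (\<integral>x. h (past 0 x) * word_weight g (past 0 x) w \<partial>P)"
  using h
proof (induction w arbitrary: h)
  case Nil
  have "cylinder [] = (UNIV :: (int \<Rightarrow> 'a) set)"
    by (simp add: cylinder_def)
  then show ?case by simp
next
  case (Cons a w)
  let ?n = "length w"
  note [measurable] = Cons.prems(1) kernel_measurable[OF g]
  \<comment> \<open>A function of the past at time \<open>n\<close>: the first \<open>n\<close>
    symbols are compared with \<open>w\<close>, and the remainder, the past at time 0, goes into
    \<open>h\<close>.\<close>
  define H where "H v = h (suffix ?n v) * indicator {w} (prefix ?n v)" for v
  have H: "H (past (int ?n) x) = h (past 0 x) * indicator (cylinder w) x" for x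
    using suffix_conc_length[of "recent ?n x"] prefix_conc_length[of "recent ?n x"]
    by (simp add: H_def past_eq_conc indicator_def cylinder_def)
  have "H \<in> borel_measurable past_space"
    unfolding H_def by measurable
  moreover have "\<forall>v. H v \<in> {0..1}"
    using Cons.prems(2) by (auto simp: H_def indicator_def)
  ultimately have "(\<integral>x. H (past (int ?n) x) * indicator {x. x (int ?n) = a} x \<partial>P) =
      (\<integral>x. H (past (int ?n) x) * g a (past (int ?n) x) \<partial>P)"
    using step[of ?n] unfolding kernel_step_def by blast
  also have "(\<integral>x. H (past (int ?n) x) * indicator {x. x (int ?n) = a} x \<partial>P) =
      (\<integral>x. h (past 0 x) * indicator (cylinder (a # w)) x \<partial>P)"
    unfolding H by (intro Bochner_Integration.integral_cong) (auto simp: indicator_def cylinder_def)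
  also have "(\<integral>x. H (past (int ?n) x) * g a (past (int ?n) x) \<partial>P) =
      (\<integral>x. (h (past 0 x) * g a (w \<frown> past 0 x)) * indicator (cylinder w) x \<partial>P)"
    unfolding H by (intro Bochner_Integration.integral_cong)
      (auto simp: indicator_def cylinder_def past_eq_conc)
  also have "\<dots> = (\<integral>x. (h (past 0 x) * g a (w \<frown> past 0 x)) * word_weight g (past 0 x) w \<partial>P)"
  proof (rule Cons.IH)
    show "(\<lambda>u. h u * g a (w \<frown> u)) \<in> borel_measurable past_space"
      by measurable
    show "h u * g a (w \<frown> u) \<in> {0..1}" for u
      using Cons.prems(2)[of u] kernel_nonneg[OF g] kernel_le_one[OF g] by (simp add: mult_le_one)
  qed
  finally show ?case
    by (simp add: mult.assoc)
qed

lemma measure_cylinder: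
  assumes "prob_kernel g" and "\<And>n. kernel_step g P (int n)"
  shows "measure P (cylinder w) = (\<integral>x. word_weight g (past 0 x) w \<partial>P)"
  using integral_cylinder[OF assms, of "\<lambda>_. 1" w] by simp

end

section \<open>Uniqueness of the law started from a past\<close>

definition is_law_from_past ::
  "('a::finite \<Rightarrow> (nat \<Rightarrow> 'a) \<Rightarrow> real) \<Rightarrow> (nat \<Rightarrow> 'a) \<Rightarrow> (int \<Rightarrow> 'a) measure \<Rightarrow> bool" where
  "is_law_from_past g u P \<longleftrightarrow> prob_space P \<and> sets P = sets (coord_algebra UNIV) \<and>
     (AE x in P. past 0 x = u) \<and> (\<forall>j\<ge>0. follows_kernel_at g P j)"

lemma is_law_from_past_cylinder:
  assumes g: "prob_kernel g" and law: "is_law_from_past g u P"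
  shows "measure P (cylinder w) = word_weight g u w"
proof -
  interpret process P
    using law by (simp add: is_law_from_past_def process_def process_axioms_def)
  have "measure P (cylinder w) = (\<integral>x. word_weight g (past 0 x) w \<partial>P)"
    using law by (intro measure_cylinder g kernel_step_of_follows) (auto simp: is_law_from_past_def)
  also have "\<dots> = (\<integral>x. word_weight g u w \<partial>P)"
    using law word_weight_measurable[OF g, measurable]
    by (intro integral_cong_AE) (auto simp: is_law_from_past_def)
  finally show ?thesis by simp
qed

text \<open>Overwriting the negative times by \<open>u\<close> turns any event into a future event,
  and changes nothing almost surely under a law whose past is \<open>u\<close>.\<close>

definition glue :: "(nat \<Rightarrow> 'a) \<Rightarrow> (int \<Rightarrow> 'a) \<Rightarrow> int \<Rightarrow> 'a" where
  "glue u x i = (if i < 0 then u (nat (- 1 - i)) else x i)"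

lemma glue_eq_iff: "glue u x = x \<longleftrightarrow> past 0 x = u"
proof
  assume "glue u x = x"
  then have "glue u x (- 1 - int n) = x (- 1 - int n)" for n
    by simp
  then show "past 0 x = u"
    by (auto simp: glue_def past_def fun_eq_iff)
next
  assume "past 0 x = u"
  then have "u n = x (- 1 - int n)" for n
    by (auto simp: past_def)
  then show "glue u x = x"
    by (auto simp: glue_def)
qed

lemma measurable_glue:
  "glue u \<in> measurable (coord_algebra {0..}) (coord_algebra UNIV :: (int \<Rightarrow> 'a::finite) measure)"
proof (rule measurable_coord_algebraI)
  show "(\<lambda>x. glue u x i) \<in> measurable (coord_algebra {0..}) (count_space UNIV)" for i
    unfolding glue_def by (cases "i < 0") (auto intro: measurable_coord)
qed

text \<open>Both laws give a cylinder its \<open>word_weight\<close>, hence agree on the future;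
  \<open>glue\<close> reduces every event to a future one.\<close>

lemma is_law_from_past_unique:
  assumes g: "prob_kernel g" and P: "is_law_from_past g u P" and Q: "is_law_from_past g u Q"
  shows "P = Q"
proof (rule measure_eqI)
  interpret P: process P
    using P by (simp add: is_law_from_past_def process_def process_axioms_def)
  interpret Q: process Q
    using Q by (simp add: is_law_from_past_def process_def process_axioms_def)
  show "sets P = sets Q" by simp
  fix A assume "A \<in> sets P"
  then have A [measurable]: "A \<in> sets (coord_algebra UNIV)"
    by simp
  define B where "B = glue u -` A"
  have B: "B \<in> sets (coord_algebra {0..})"
    using measurable_sets[OF measurable_glue A] by (simp add: B_def)
  have [simp]: "B \<in> sets (coord_algebra UNIV)"
    using B sets_coord_algebra_mono[of "{0..}" UNIV] by auto
  have "measure P A = measure P B"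
  proof (rule P.finite_measure_eq_AE)
    have "AE x in P. past 0 x = u" using P by (simp add: is_law_from_past_def)
    then show "AE x in P. x \<in> A \<longleftrightarrow> x \<in> B"
      by eventually_elim (metis B_def glue_eq_iff vimage_eq)
  qed (use A in auto)
  also have "measure P B = (\<integral>y. measure Q B \<partial>P)"
  proof (rule mixture_on_future[OF P.prob_space_axioms P.prob_space_axioms])
    show "measure P (cylinder w) = (\<integral>y. measure Q (cylinder w) \<partial>P)" for w
      unfolding is_law_from_past_cylinder[OF g P] is_law_from_past_cylinder[OF g Q] by simp
  qed (simp_all add: B Q.prob_space_axioms)
  also have "\<dots> = measure Q B"
    by simp
  also have "\<dots> = measure Q A"
  proof (rule Q.finite_measure_eq_AE)
    have "AE x in Q. past 0 x = u" using Q by (simp add: is_law_from_past_def)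
    then show "AE x in Q. x \<in> B \<longleftrightarrow> x \<in> A"
      by eventually_elim (metis B_def glue_eq_iff vimage_eq)
  qed (use A in auto)
  finally show "emeasure P A = emeasure Q A"
    by (simp add: P.emeasure_eq_measure Q.emeasure_eq_measure)
qed

subsection \<open>Existence of the law started from a past\<close>

text \<open>The counterpart of \<open>recent\<close> for trajectories indexed by \<open>nat\<close>,
  the form in which the Ionescu-Tulcea construction delivers them.\<close>

primrec history :: "nat \<Rightarrow> (nat \<Rightarrow> 'a) \<Rightarrow> 'a list" where
  "history 0 y = []"
| "history (Suc n) y = y n # history n y"

lemma history_cong: "(\<And>i. i < n \<Longrightarrow> y i = z i) \<Longrightarrow> history n y = history n z"
  by (induction n) auto

locale kernel_from_past =
  fixes g :: "'a::finite \<Rightarrow> (nat \<Rightarrow> 'a) \<Rightarrow> real" and u :: "nat \<Rightarrow> 'a"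
  assumes kernel: "prob_kernel g"
begin

definition step_measure :: "nat \<Rightarrow> (nat \<Rightarrow> 'a) \<Rightarrow> 'a measure" where
  "step_measure n y = point_measure UNIV (\<lambda>a. ennreal (g a (history n y \<frown> u)))"

lemma prob_space_step_measure: "prob_space (step_measure n y)"
proof
  have "emeasure (step_measure n y) UNIV = (\<Sum>a\<in>UNIV. ennreal (g a (history n y \<frown> u)))"
    unfolding step_measure_def by (subst emeasure_point_measure_finite) auto
  also have "\<dots> = ennreal (\<Sum>a\<in>UNIV. g a (history n y \<frown> u))"
    by (intro sum_ennreal) (simp add: kernel_nonneg[OF kernel])
  finally show "emeasure (step_measure n y) (space (step_measure n y)) = 1"
    by (simp add: kernel_sum[OF kernel] step_measure_def space_point_measure)
qed

sublocale Ionescu_Tulcea step_measure "\<lambda>_. count_space UNIV"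
proof (rule Ionescu_Tulcea.intro)
  fix n :: nat
  \<comment> \<open>A finite product of finite alphabets is discrete, so every map out of it is
    measurable.\<close>
  have "Pi\<^sub>M {0..<n} (\<lambda>_. count_space (UNIV :: 'a set)) = count_space (Pi\<^sub>E {0..<n} (\<lambda>_. UNIV))"
    by (intro count_space_PiM_finite) auto
  then show "step_measure n \<in> measurable (Pi\<^sub>M {0..<n} (\<lambda>_. count_space UNIV))
      (subprob_algebra (count_space UNIV))"
    using prob_space_imp_subprob_space[OF prob_space_step_measure]
    by (simp add: space_subprob_algebra step_measure_def sets_point_measure)
qed (rule prob_space_step_measure)

definition words :: "'a list \<Rightarrow> (nat \<Rightarrow> 'a) set" where
  "words w = {y \<in> Pi\<^sub>E {0..<length w} (\<lambda>_. UNIV). history (length w) y = w}"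

lemma words_in_sets:
  "words w \<in> sets (Pi\<^sub>M {0..<length w} (\<lambda>_. count_space UNIV))"
  by (subst count_space_PiM_finite) (auto simp: words_def)

text \<open>The induction follows the construction: \<open>a # w\<close> is read after one more step
  exactly if \<open>w\<close> was read before and \<open>a\<close> is drawn next, which reproduces
  the recursion of \<open>word_weight\<close>.\<close>

lemma emeasure_words:
  "emeasure (C 0 (length w) (\<lambda>_. undefined)) (words w) = ennreal (word_weight g u w)"
proof (induction w)
  case Nil
  have "words [] = {\<lambda>_. undefined}"
    by (auto simp: words_def)
  then show ?case
    using words_in_sets[of "[]"] by (simp add: emeasure_return)
next
  case (Cons a w)
  let ?n = "length w"
  let ?C = "C 0 ?n (\<lambda>_. undefined)"
  have space_C: "space ?C = Pi\<^sub>E {0..<?n} (\<lambda>_. UNIV)"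
    by (simp add: space_C space_PiM)
  have sets_C: "sets ?C = sets (Pi\<^sub>M {0..<?n} (\<lambda>_. count_space UNIV))"
    by (simp add: sets_C)
  have eP: "emeasure (eP ?n y) (words (a # w)) = ennreal (g a (w \<frown> u)) * indicator (words w) y"
    if y: "y \<in> space ?C" for y
  proof -
    have "history ?n (y(?n := b)) = history ?n y" for b
      by (rule history_cong) auto
    \<comment> \<open>The coordinate written in this step has index \<open>?n\<close>, and
      \<open>history ?n\<close> reads only smaller indices.\<close>
    then have "(\<lambda>b. y(?n := b)) -` words (a # w) = (if y \<in> words w then {a} else {})"
      using y by (auto simp: words_def space_C PiE_iff extensional_def)
    moreover have "y \<in> words w \<Longrightarrow> history ?n y = w"
      by (simp add: words_def)
    ultimately show ?thesis
      using y words_in_sets[of "a # w"]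
      by (subst emeasure_eP)
         (auto simp: space_C space_PiM step_measure_def emeasure_point_measure_finite)
  qed
  have "emeasure (C 0 (Suc ?n) (\<lambda>_. undefined)) (words (a # w)) =
      (\<integral>\<^sup>+y. emeasure (eP ?n y) (words (a # w)) \<partial>?C)"
    using words_in_sets[of "a # w"] measurable_eP[of ?n] sets_C space_C
    by (simp add: emeasure_bind[where N="Pi\<^sub>M {0..<Suc ?n} (\<lambda>_. count_space UNIV)"]
          PiE_eq_empty_iff cong: measurable_cong_sets)
  also have "\<dots> = (\<integral>\<^sup>+y. ennreal (g a (w \<frown> u)) * indicator (words w) y \<partial>?C)"
    by (intro nn_integral_cong eP)
  also have "\<dots> = ennreal (g a (w \<frown> u)) * emeasure ?C (words w)"
    using words_in_sets[of w] sets_C by (intro nn_integral_cmult_indicator) auto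
  finally show ?case
    by (simp add: Cons.IH ennreal_mult' kernel_nonneg[OF kernel])
qed

definition future :: "(nat \<Rightarrow> 'a) \<Rightarrow> int \<Rightarrow> 'a" where
  "future y i = (if i < 0 then u (nat (- 1 - i)) else y (nat i))"

lemma recent_future: "recent n (future y) = history n y"
  by (induction n) (auto simp: future_def)

lemma past_future: "past 0 (future y) = u"
  by (auto simp: past_def future_def)

definition law :: "(int \<Rightarrow> 'a) measure" where
  "law = distr PF.lim (coord_algebra UNIV) future"

lemma measurable_future: "future \<in> measurable PF.lim (coord_algebra UNIV)"
proof (rule measurable_coord_algebraI)
  show "(\<lambda>y. future y i) \<in> measurable PF.lim (count_space UNIV)" for i
    unfolding future_def measurable_cong_sets[OF PF.sets_lim refl] by (cases "i < 0") auto
qed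

lemma process_law: "process law"
proof -
  let ?M = "\<lambda>_ :: nat. count_space (UNIV :: 'a set)"
  \<comment> \<open>The total mass of the limit is read off its projection to the empty index set,
    which is a probability measure.\<close>
  interpret lim: prob_space PF.lim
  proof (rule prob_space_distrD)
    show "(\<lambda>y. restrict y {}) \<in> measurable PF.lim (Pi\<^sub>M {} ?M)"
      unfolding measurable_cong_sets[OF PF.sets_lim refl] by (rule measurable_restrict_subset) simp
    show "prob_space (distr PF.lim (Pi\<^sub>M {} ?M) (\<lambda>y. restrict y {}))"
      using PF.prob_space_P[of "{}"] by (simp add: distr_lim)
  qed
  show ?thesis
    using lim.prob_space_distr[OF measurable_future]
    by (simp add: law_def process_def process_axioms_def)
qed

lemma measure_law_cylinder: "measure law (cylinder w) = word_weight g u w"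
proof -
  let ?M = "\<lambda>_ :: nat. count_space (UNIV :: 'a set)"
  have "history (length w) (restrict y {0..<length w}) = history (length w) y" for y :: "nat \<Rightarrow> 'a"
    by (rule history_cong) auto
  \<comment> \<open>A cylinder depends on finitely many draws, so its probability is that of a
    finite stage of the construction.\<close>
  then have "future -` cylinder w \<inter> space PF.lim = prod_emb UNIV ?M {0..<length w} (words w)"
    by (auto simp: cylinder_def recent_future words_def prod_emb_def space_PiM)
  then have "emeasure law (cylinder w) = emeasure PF.lim (prod_emb UNIV ?M {0..<length w} (words w))"
    unfolding law_def by (subst emeasure_distr) (auto intro: measurable_future cylinder_in_sets)
  also have "\<dots> = emeasure (C 0 (length w) (\<lambda>_. undefined)) (words w)"
    using words_in_sets[of w] sets.sets_into_space[OF words_in_sets[of w]]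
    by (simp add: lim emeasure_CI[of _ "length w"] prod_emb_id space_PiM)
  finally show ?thesis
    by (simp add: emeasure_words measure_def word_weight_nonneg[OF kernel])
qed

lemma AE_law_past: "AE x in law. past 0 x = u"
proof -
  have "{x. past 0 x = u} = (\<Inter>n. {x. x (- 1 - int n) = u n})"
    by (auto simp: past_def fun_eq_iff)
  also have "\<dots> \<in> sets (coord_algebra UNIV)"
    by (intro sets.countable_INT') (auto simp: coord_algebra_def)
  finally show ?thesis
    unfolding law_def by (subst AE_distr_iff) (auto simp: past_future measurable_future)
qed

end

section \<open>The constructed law follows the kernel\<close>

lemma past_determines_event:
  assumes "A \<in> sets (coord_algebra {..j - 1})" and eq: "past j x = past j y"
  shows "x \<in> A \<longleftrightarrow> y \<in> A"
proof -
  have agree: "x i = y i" if "i \<le> j - 1" for i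
    using fun_cong[OF eq, of "nat (j - 1 - i)"] that by (simp add: past_def)
  have "A \<in> sigma_sets UNIV {{x. x i = a} |i a. i \<in> {..j - 1}}"
    using assms(1) by (simp add: coord_algebra_def)
  then show ?thesis
    by (induction rule: sigma_sets.induct) (auto simp: agree)
qed

context kernel_from_past
begin

interpretation process law
  by (rule process_law)

text \<open>As the past at time 0 is almost surely \<open>u\<close>, an event before time
  \<open>n\<close> is, up to a null set, a finite union of cylinders of length \<open>n\<close>:
  those words which followed by \<open>u\<close> form the past of some point of \<open>A\<close>.
  Both sides of the identity characterising the conditional expectation are expanded in this
  way.\<close>

lemma set_integral_coord:
  fixes f :: "(int \<Rightarrow> 'a) \<Rightarrow> real"
  assumes A: "A \<in> sets (coord_algebra {..int n - 1})" and f: "f \<in> borel_measurable law"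
    and f_cyl: "\<And>x w. past 0 x = u \<Longrightarrow> length w = n \<Longrightarrow> x \<in> cylinder w \<Longrightarrow> f x = F w x"
    and F: "\<And>w. length w = n \<Longrightarrow> integrable law (\<lambda>x. F w x * indicator (cylinder w) x)"
  shows "(\<integral>x\<in>A. f x \<partial>law) =
    (\<Sum>w | length w = n \<and> (\<exists>y\<in>A. past (int n) y = w \<frown> u). \<integral>x. F w x * indicator (cylinder w) x \<partial>law)"
proof -
  define V where "V = {w. length w = n \<and> (\<exists>y\<in>A. past (int n) y = w \<frown> u)}"
  have fin: "finite V"
    using finite_lists_length_eq[of "UNIV :: 'a set" n] by (auto simp: V_def intro: rev_finite_subset)
  have [measurable]: "A \<in> sets law"
    using A sets_coord_algebra_mono[of "{..int n - 1}" UNIV] by auto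
  have "AE x in law. indicator A x * f x = (\<Sum>w\<in>V. F w x * indicator (cylinder w) x)"
    using AE_law_past
  proof eventually_elim
    case (elim x)
    let ?w = "recent n x"
    have past_x: "past (int n) x = ?w \<frown> u"
      using past_eq_conc[of n x] elim by simp
    have "x \<in> A \<longleftrightarrow> ?w \<in> V"
    proof
      assume "?w \<in> V"
      then obtain y where "y \<in> A" "past (int n) y = ?w \<frown> u"
        by (auto simp: V_def)
      with past_x show "x \<in> A"
        using past_determines_event[OF A, of x y] by simp
    qed (use past_x in \<open>auto simp: V_def\<close>)
    moreover have "indicator (cylinder w) x = (if w = ?w then 1 else 0 :: real)" if "w \<in> V" for w
      using that by (auto simp: V_def cylinder_def)
    then have "(\<Sum>w\<in>V. F w x * indicator (cylinder w) x) = (\<Sum>w\<in>V. if w = ?w then F w x else 0)"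
      by (intro sum.cong) auto
    moreover have "f x = F ?w x"
      using elim by (intro f_cyl) (auto simp: cylinder_def)
    ultimately show ?case
      using fin by (auto simp: indicator_def)
  qed
  then have "(\<integral>x. indicator A x * f x \<partial>law) = (\<integral>x. (\<Sum>w\<in>V. F w x * indicator (cylinder w) x) \<partial>law)"
    using F f by (intro integral_cong_AE) (auto simp: V_def intro!: borel_measurable_sum)
  also have "\<dots> = (\<Sum>w\<in>V. \<integral>x. F w x * indicator (cylinder w) x \<partial>law)"
    using F by (intro Bochner_Integration.integral_sum) (auto simp: V_def)
  finally show ?thesis
    by (simp add: V_def set_lebesgue_integral_def)
qed

lemma follows_law: "follows_kernel_at g law (int n)"
  unfolding follows_kernel_at_def
proof
  fix a
  let ?F = "coord_algebra {..int n - 1} :: (int \<Rightarrow> 'a) measure"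
  interpret F: sigma_finite_subalgebra law ?F
    by (rule sigma_finite_coord)
  note [measurable] = kernel_measurable[OF kernel]
  show "AE x in law. real_cond_exp law ?F (indicator {x. x (int n) = a}) x = g a (past (int n) x)"
  proof (rule F.real_cond_exp_charact)
    show "integrable law (\<lambda>x. g a (past (int n) x))"
    proof (rule integrable_unit_interval)
      show "g a (past (int n) x) \<in> {0..1}" for x
        by (simp add: kernel_nonneg[OF kernel] kernel_le_one[OF kernel])
    qed measurable
    show "(\<lambda>x. g a (past (int n) x)) \<in> borel_measurable ?F"
      by (rule measurable_compose[OF measurable_past kernel_measurable[OF kernel]]) auto
    show "integrable law (indicator {x. x (int n) = a} :: _ \<Rightarrow> real)"
      by (rule integrable_unit_interval) (rule borel_measurable_indicator[OF coord_event], simp)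
    fix A assume A: "A \<in> sets ?F"
    have "(\<integral>x\<in>A. (indicator {x. x (int n) = a} x :: real) \<partial>law) =
      (\<Sum>w | length w = n \<and> (\<exists>y\<in>A. past (int n) y = w \<frown> u).
        \<integral>x. indicator {x. x (int n) = a} x * indicator (cylinder w) x \<partial>law)"
    proof (rule set_integral_coord[OF A])
      show "integrable law (\<lambda>x. indicator {x. x (int n) = a} x * indicator (cylinder w) x :: real)" for w
        by (rule integrable_unit_interval) (measurable, simp add: indicator_def)
    qed (rule borel_measurable_indicator[OF coord_event], simp)
    \<comment> \<open>The sums run over the same words and agree term by term: prolonging
      \<open>w\<close> by \<open>a\<close> multiplies its weight by
      \<open>g a (w \<frown> u)\<close>.\<close>
    also have "\<dots> = (\<Sum>w | length w = n \<and> (\<exists>y\<in>A. past (int n) y = w \<frown> u).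
        \<integral>x. g a (w \<frown> u) * indicator (cylinder w) x \<partial>law)"
    proof (rule sum.cong[OF refl])
      fix w assume "w \<in> {w. length w = n \<and> (\<exists>y\<in>A. past (int n) y = w \<frown> u)}"
      then have "length w = n" by simp
      then have "indicator {x. x (int n) = a} x * indicator (cylinder w) x =
          (indicator (cylinder (a # w)) x :: real)" for x
        by (auto simp: cylinder_def indicator_def)
      then show "(\<integral>x. indicator {x. x (int n) = a} x * indicator (cylinder w) x \<partial>law) =
          (\<integral>x. g a (w \<frown> u) * indicator (cylinder w) x \<partial>law)"
        by (simp add: measure_law_cylinder)
    qed
    also have "\<dots> = (\<integral>x\<in>A. g a (past (int n) x) \<partial>law)"
    proof (rule set_integral_coord[OF A, symmetric])
      show "g a (past (int n) x) = g a (w \<frown> u)"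
        if "past 0 x = u" "length w = n" "x \<in> cylinder w" for x w
        using that past_eq_conc[of n x] by (simp add: cylinder_def)
      show "integrable law (\<lambda>x. g a (w \<frown> u) * indicator (cylinder w) x)" for w
        by (intro integrable_mult_right integrable_unit_interval borel_measurable_indicator cylinder_event) simp
    qed measurable
    finally show "(\<integral>x\<in>A. (indicator {x. x (int n) = a} x :: real) \<partial>law) = (\<integral>x\<in>A. g a (past (int n) x) \<partial>law)" .
  qed
qed

lemma is_law_from_past_law: "is_law_from_past g u law"
  unfolding is_law_from_past_def
proof (intro conjI allI impI)
  show "follows_kernel_at g law j" if "j \<ge> 0" for j
    using follows_law[of "nat j"] that by simp
qed (auto simp: prob_space_axioms AE_law_past)

end

text \<open>Existence and uniqueness together give access to the definite description in
  \<open>law_from_past\<close>.\<close>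

lemma is_law_from_past_law_from_past:
  assumes "prob_kernel g"
  shows "is_law_from_past g u (law_from_past g u)"
proof -
  interpret kernel_from_past g u
    by standard fact
  have "\<exists>!P. is_law_from_past g u P"
    using is_law_from_past_law is_law_from_past_unique[OF assms] by blast
  then show ?thesis
    using theI'[of "is_law_from_past g u"]
    by (simp add: law_from_past_def is_law_from_past_def[abs_def])
qed

subsection \<open>Dynamic uniqueness forces equality of stationary measures\<close>

lemma g_measure_process:
  assumes "g_measure g P"
  shows "process P"
  using assms by (simp add: g_measure_def process_def process_axioms_def)

text \<open>Decompose \<open>P\<close> over its past at time 0. On a tail event dynamic uniqueness
  makes the integrand constant, equal to its value for any chosen past \<open>v\<close>.\<close>

lemma g_measure_tail_event:
  assumes g: "prob_kernel g" and P: "g_measure g P"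
    and "dynamic_uniqueness g" and A: "A \<in> tail_events"
  shows "measure P A = measure (law_from_past g v) A"
proof -
  interpret process P
    by (rule g_measure_process) fact
  have law: "is_law_from_past g u (law_from_past g u)" for u
    by (rule is_law_from_past_law_from_past) fact
  have step: "kernel_step g P (int n)" for n
    using P by (intro kernel_step_time_shift kernel_step_of_follows g) (auto simp: g_measure_def)
  have "measure P A = (\<integral>x. measure (law_from_past g (past 0 x)) A \<partial>P)"
  proof (rule mixture_on_future[OF prob_space_axioms prob_space_axioms sets_P])
    show "prob_space (law_from_past g (past 0 x))"
        "sets (law_from_past g (past 0 x)) = sets (coord_algebra UNIV)" for x
      using law by (auto simp: is_law_from_past_def)
    show "(\<lambda>x. measure (law_from_past g (past 0 x)) (cylinder w)) \<in> borel_measurable P" for w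
      unfolding is_law_from_past_cylinder[OF g law]
      by (rule measurable_compose[OF past_measurable word_weight_measurable[OF g]])
    show "measure P (cylinder w) = (\<integral>x. measure (law_from_past g (past 0 x)) (cylinder w) \<partial>P)" for w
      unfolding is_law_from_past_cylinder[OF g law] by (rule measure_cylinder[OF g step])
    \<comment> \<open>Tail events are intersected from time 1 on, while the mixture formula covers
      the future from time 0.\<close>
    have "A \<in> sets (coord_algebra {1..})"
      using A by (auto simp: Defs.tail_events_def)
    then show "A \<in> sets (coord_algebra {0..})"
      using sets_coord_algebra_mono[of "{1..}" "{0..}"] by auto
  qed
  also have "\<dots> = (\<integral>x. measure (law_from_past g v) A \<partial>P)"
    using assms(3) A unfolding dynamic_uniqueness_def by metis
  finally show ?thesis by simp
qed

section \<open>Stationary measures with a common tail\<close>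

lemma time_shift_vimage:
  assumes "C \<in> sets (coord_algebra I)" and "\<And>i. i \<in> I \<Longrightarrow> i + int n \<in> J"
  shows "time_shift n -` C \<in> sets (coord_algebra J :: (int \<Rightarrow> 'a::finite) measure)"
  using measurable_sets[OF measurable_time_shift[of I n J] assms(1)] assms(2) by simp

lemma (in process) measure_time_shift:
  assumes "stationary P" and "C \<in> sets (coord_algebra UNIV)"
  shows "measure P (time_shift n -` C) = measure P C"
  using measure_distr[OF time_shift_measurable, of C n] assms distr_time_shift[OF assms(1), of n]
  by simp

text \<open>Equality spreads from the tail to the future by the limit argument, from there to all
  half-lines by stationarity, and finally to all events because the half-line events form a
  generating \<pi>-system.\<close>

lemma stationary_eq_of_agree_on_tail:
  assumes P: "process P" "stationary P" and Q: "process Q" "stationary Q"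
    and agree: "\<And>A. A \<in> tail_events \<Longrightarrow> measure P A = measure Q A"
  shows "P = Q"
proof -
  interpret P: process P by fact
  interpret Q: process Q by fact
  have future: "measure P C = measure Q C" if C: "C \<in> sets (coord_algebra {0..})" for C
  proof (rule limit_integral_eq_of_agree_on_tail[OF P.prob_space_axioms Q.prob_space_axioms])
    let ?F = "\<lambda>n. coord_algebra {int n..} :: (int \<Rightarrow> 'a) measure"
    show "subalgebra P (?F n)" "subalgebra Q (?F n)" for n
      by (rule P.subalgebra_coord Q.subalgebra_coord)+
    show "decseq (\<lambda>n. sets (?F n))"
      by (intro decseq_SucI sets_coord_algebra_mono) auto
    show "measure P A = measure Q A" if "\<And>n. A \<in> sets (?F n)" for A
    proof (rule agree)
      have "A \<in> sets (coord_algebra {n..})" if "n \<ge> 1" for n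
        using \<open>\<And>n. A \<in> sets (?F n)\<close>[of "nat n"] that by simp
      then show "A \<in> tail_events"
        by (auto simp: tail_events_def)
    qed
    fix n
    have C': "C \<in> sets (coord_algebra UNIV)"
      using C sets_coord_algebra_mono[of "{0..}" UNIV] by auto
    have meas: "time_shift n -` C \<in> sets (?F n)"
      by (rule time_shift_vimage[OF C]) auto
    show "\<exists>f\<in>borel_measurable (?F n). (\<forall>x. f x \<in> {0..1}) \<and>
        (\<integral>x. f x \<partial>P) = measure P C \<and> (\<integral>x. f x \<partial>Q) = measure Q C"
      using P.measure_time_shift[OF P(2) C'] Q.measure_time_shift[OF Q(2) C']
      by (intro bexI[of _ "indicator (time_shift n -` C)"] borel_measurable_indicator meas)
         (simp add: indicator_pos_le indicator_le_1)
  qed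
  have half_line: "measure P C = measure Q C"
    if C: "C \<in> sets (coord_algebra {- int n..})" for C n
  proof -
    have C': "C \<in> sets (coord_algebra UNIV)"
      using C sets_coord_algebra_mono[of "{- int n..}" UNIV] by auto
    \<comment> \<open>Translating by \<open>n\<close> moves the half-line starting at
      \<open>- int n\<close> to the one starting at 0.\<close>
    have "measure P (time_shift n -` C) = measure Q (time_shift n -` C)"
      by (intro future time_shift_vimage[OF C]) auto
    then show ?thesis
      by (simp add: P.measure_time_shift[OF P(2) C'] Q.measure_time_shift[OF Q(2) C'])
  qed
  let ?E = "\<Union>n. sets (coord_algebra {- int n..} :: (int \<Rightarrow> 'a) measure)"
  have E_subset: "?E \<subseteq> sets (coord_algebra UNIV)"
    using sets_coord_algebra_mono[of _ UNIV] by blast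
  have generates: "sets (coord_algebra UNIV) = sigma_sets UNIV ?E"
  proof
    show "sigma_sets UNIV ?E \<subseteq> sets (coord_algebra UNIV)"
      using sets.sigma_sets_subset[OF E_subset] by simp
    have "{{x. x i = a} |i a. i \<in> UNIV} \<subseteq> ?E"
    proof clarify
      fix i :: int and a :: 'a
      have "{x. x i = a} \<in> {{x. x k = b} |k b. k \<in> {- int (nat \<bar>i\<bar>)..}}"
        by (intro CollectI exI[of _ i] exI[of _ a]) simp
      then have "{x. x i = a} \<in> sets (coord_algebra {- int (nat \<bar>i\<bar>)..})"
        unfolding coord_algebra_def by (subst sets_measure_of) (auto intro: sigma_sets.Basic)
      then show "{x. x i = a} \<in> ?E"
        by blast
    qed
    then show "sets (coord_algebra UNIV) \<subseteq> sigma_sets UNIV ?E"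
      by (auto simp: coord_algebra_def dest: sigma_sets_mono')
  qed
  show ?thesis
  proof (rule measure_eqI_generator_eq[where E="?E" and \<Omega>=UNIV and A="\<lambda>_. UNIV"])
    show "Int_stable ?E"
    \<comment> \<open>Half-lines are nested, so two such events both belong to the longer
      one.\<close>
    proof (rule Int_stableI, clarify)
      fix A B :: "(int \<Rightarrow> 'a) set" and m n :: nat
      assume "A \<in> sets (coord_algebra {- int m..})" "B \<in> sets (coord_algebra {- int n..})"
      then have "A \<in> sets (coord_algebra {- int (max m n)..})" "B \<in> sets (coord_algebra {- int (max m n)..})"
        using sets_coord_algebra_mono[of "{- int m..}" "{- int (max m n)..}"]
          sets_coord_algebra_mono[of "{- int n..}" "{- int (max m n)..}"] by auto
      then show "A \<inter> B \<in> ?E"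
        by blast
    qed
    show "range (\<lambda>_::nat. UNIV) \<subseteq> ?E"
      using sets.top[of "coord_algebra _"] by auto
    show "emeasure P X = emeasure Q X" if "X \<in> ?E" for X
      using that half_line by (auto simp: P.emeasure_eq_measure Q.emeasure_eq_measure)
  qed (auto simp: generates)
qed

theorem corollary1:
  fixes g :: "'a::finite \<Rightarrow> (nat \<Rightarrow> 'a) \<Rightarrow> real"
  assumes "prob_kernel g"
    and "regular_kernel g"
    and "equilibrium_phase_transition g"
  shows "dynamic_phase_transition g"
  unfolding dynamic_phase_transition_def
proof
  assume unique: "dynamic_uniqueness g"
  obtain P Q where P: "g_measure g P" and Q: "g_measure g Q" and "P \<noteq> Q"
    using assms(3) by (auto simp: equilibrium_phase_transition_def)
  have "measure P A = measure Q A" if "A \<in> tail_events" for A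
    using g_measure_tail_event[OF assms(1) P unique that] g_measure_tail_event[OF assms(1) Q unique that]
    by simp
  then have "P = Q"
    using P Q by (intro stationary_eq_of_agree_on_tail g_measure_process) (auto simp: g_measure_def)
  with \<open>P \<noteq> Q\<close> show False ..
qed

end
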